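(* Let $(\Sigma_1,g_1)$ and $(\Sigma_2,g_2)$ be connected, complete, oriented Riemannian 2-manifolds and $\epsilon\in\{1,-1\}$. There are no Lagrangian immersions of a (nonempty) surface in $(\Sigma_1\times\Sigma_2,\Omega^{\epsilon})$ of projected rank zero.
   Context: For $k=1,2$, $j_k$ is the rotation by $+\pi/2$ in $T\Sigma_k$ and $\omega_k(\cdot,\cdot)=g_k(j_k\cdot,\cdot)$. Let $\pi_i:\Sigma_1\times\Sigma_2\to\Sigma_i$ be the projections and $\Omega^{\epsilon}=\pi_1^{*}\omega_1+\epsilon\,\pi_2^{*}\omega_2$. An immersion $\Phi:S\to\Sigma_1\times\Sigma_2$ of a surface $S$ is Lagrangian if $\Phi^{*}\Omega^{\epsilon}=0$. Write $\Phi=(\phi,\psi)$ with $\phi=\pi_1\circ\Phi$, $\psi=\pi_2\circ\Phi$; the rank of a map at a point is the rank of its derivative there. $\Phi$ is of projected rank zero at $p\in S$ if $\mathrm{rank}(\phi)=0$ or $\mathrm{rank}(\psi)=0$ at $p$, and of projected rank zero if this holds at every $p\in S$. *)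

theory Defs
  imports "HOL-Analysis.Analysis" "HOL-Library.Function_Algebras"
begin

instantiation "fun" :: (type, real_vector) real_vector
begin

definition scaleR_fun :: "real \<Rightarrow> ('a \<Rightarrow> 'b) \<Rightarrow> 'a \<Rightarrow> 'b" where
  "scaleR_fun r f = (\<lambda>x. r *\<^sub>R f x)"

instance
  by standard (simp_all add: scaleR_fun_def fun_eq_iff scaleR_add_right scaleR_add_left)

end


section \<open>Smooth manifolds\<close>

text \<open>\<open>Ck_on k U f\<close> is meant for open \<open>U\<close>.\<close>

primrec Ck_on :: "nat \<Rightarrow> 'e set \<Rightarrow> ('e::euclidean_space \<Rightarrow> 'f::real_normed_vector) \<Rightarrow> bool" where
  "Ck_on 0 U f \<longleftrightarrow> continuous_on U f"
| "Ck_on (Suc k) U f \<longleftrightarrow>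
     (\<forall>x\<in>U. f differentiable (at x)) \<and> (\<forall>v. Ck_on k U (\<lambda>x. frechet_derivative f (at x) v))"

definition smooth_on :: "'e set \<Rightarrow> ('e::euclidean_space \<Rightarrow> 'f::real_normed_vector) \<Rightarrow> bool" where
  "smooth_on U f \<longleftrightarrow> (\<forall>k. Ck_on k U f)"

text \<open>A chart is a domain together with a coordinate map; only the values of the
  coordinate map on the domain matter.\<close>

type_synonym ('a, 'e) chart = "'a set \<times> ('a \<Rightarrow> 'e)"

record ('a, 'e) manifold =
  mtop :: "'a topology"
  atlas :: "('a, 'e) chart set"

definition chart_inv :: "('a, 'e) chart \<Rightarrow> 'e \<Rightarrow> 'a" where
  "chart_inv c = inv_into (fst c) (snd c)"

definition transition :: "('a, 'e) chart \<Rightarrow> ('a, 'e) chart \<Rightarrow> 'e \<Rightarrow> 'e" where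
  "transition c d = snd d \<circ> chart_inv c"

definition points :: "('a, 'e) manifold \<Rightarrow> 'a set" where
  "points M = topspace (mtop M)"

definition charts_at :: "('a, 'e) manifold \<Rightarrow> 'a \<Rightarrow> ('a, 'e) chart set" where
  "charts_at M p = {c \<in> atlas M. p \<in> fst c}"

text \<open>The smooth structure is given by some smooth atlas, which need not be maximal;
  the dimension is that of the model space \<open>'e\<close>.\<close>

definition smooth_manifold :: "('a, 'e::euclidean_space) manifold \<Rightarrow> bool" where
  "smooth_manifold M \<longleftrightarrow>
     Hausdorff_space (mtop M) \<and> second_countable (mtop M) \<and>
     (\<forall>c\<in>atlas M. openin (mtop M) (fst c) \<and> open (snd c ` fst c) \<and>
        homeomorphic_map (subtopology (mtop M) (fst c)) (top_of_set (snd c ` fst c)) (snd c)) \<and>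
     (\<Union>c\<in>atlas M. fst c) = points M \<and>
     (\<forall>c\<in>atlas M. \<forall>d\<in>atlas M. smooth_on (snd c ` (fst c \<inter> fst d)) (transition c d))"

definition smooth_map ::
  "('a, 'e::euclidean_space) manifold \<Rightarrow> ('b, 'f::euclidean_space) manifold \<Rightarrow> ('a \<Rightarrow> 'b) \<Rightarrow> bool" where
  "smooth_map M N f \<longleftrightarrow>
     continuous_map (mtop M) (mtop N) f \<and>
     (\<forall>c\<in>atlas M. \<forall>d\<in>atlas N.
        smooth_on (snd c ` {p \<in> fst c. f p \<in> fst d}) (snd d \<circ> f \<circ> chart_inv c))"

definition product_manifold ::
  "('a, 'e) manifold \<Rightarrow> ('b, 'f) manifold \<Rightarrow> ('a \<times> 'b, 'e \<times> 'f) manifold" where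
  "product_manifold M N =
     \<lparr>mtop = prod_topology (mtop M) (mtop N),
      atlas = {(fst c \<times> fst d, map_prod (snd c) (snd d)) | c d. c \<in> atlas M \<and> d \<in> atlas N}\<rparr>"


section \<open>Tangent spaces and differentials\<close>

text \<open>A tangent vector at \<open>p\<close> is the family of its coordinate representatives in all the
  charts around \<open>p\<close>, related by the derivatives of the transition maps. The value at
  every other chart is set to \<open>0\<close>, so that the tangent spaces are linear subspaces of a
  function space.\<close>

type_synonym ('a, 'e) tvec = "('a, 'e) chart \<Rightarrow> 'e"

definition tangent_space :: "('a, 'e::euclidean_space) manifold \<Rightarrow> 'a \<Rightarrow> ('a, 'e) tvec set" where
  "tangent_space M p =
     {v. (\<forall>c. c \<notin> charts_at M p \<longrightarrow> v c = 0) \<and>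
         (\<forall>c\<in>charts_at M p. \<forall>d\<in>charts_at M p.
            v d = frechet_derivative (transition c d) (at (snd c p)) (v c))}"

text \<open>The tangent vector at \<open>p\<close> represented by \<open>a\<close> in the chart \<open>c\<close>.\<close>

definition coord_vector ::
  "('a, 'e::euclidean_space) manifold \<Rightarrow> ('a, 'e) chart \<Rightarrow> 'a \<Rightarrow> 'e \<Rightarrow> ('a, 'e) tvec" where
  "coord_vector M c p a =
     (\<lambda>d. if d \<in> charts_at M p then frechet_derivative (transition c d) (at (snd c p)) a else 0)"

text \<open>By the chain rule, the choice of the chart \<open>c\<close> is immaterial.\<close>

definition differential ::
  "('a, 'e::euclidean_space) manifold \<Rightarrow> ('b, 'f::euclidean_space) manifold \<Rightarrow> ('a \<Rightarrow> 'b) \<Rightarrow>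
   'a \<Rightarrow> ('a, 'e) tvec \<Rightarrow> ('b, 'f) tvec" where
  "differential M N f p v =
     (let c = (SOME c. c \<in> charts_at M p) in
      (\<lambda>d. if d \<in> charts_at N (f p)
           then frechet_derivative (snd d \<circ> f \<circ> chart_inv c) (at (snd c p)) (v c) else 0))"

definition rank_at ::
  "('a, 'e::euclidean_space) manifold \<Rightarrow> ('b, 'f::euclidean_space) manifold \<Rightarrow> ('a \<Rightarrow> 'b) \<Rightarrow>
   'a \<Rightarrow> nat" where
  "rank_at M N f p = dim (differential M N f p ` tangent_space M p)"

definition immersion ::
  "('a, 'e::euclidean_space) manifold \<Rightarrow> ('b, 'f::euclidean_space) manifold \<Rightarrow> ('a \<Rightarrow> 'b) \<Rightarrow> bool" where
  "immersion M N f \<longleftrightarrow>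
     smooth_map M N f \<and> (\<forall>p\<in>points M. inj_on (differential M N f p) (tangent_space M p))"

definition pullback ::
  "('a, 'e::euclidean_space) manifold \<Rightarrow> ('b, 'f::euclidean_space) manifold \<Rightarrow> ('a \<Rightarrow> 'b) \<Rightarrow>
   ('b \<Rightarrow> ('b, 'f) tvec \<Rightarrow> ('b, 'f) tvec \<Rightarrow> real) \<Rightarrow>
   'a \<Rightarrow> ('a, 'e) tvec \<Rightarrow> ('a, 'e) tvec \<Rightarrow> real" where
  "pullback M N f \<alpha> p v w = \<alpha> (f p) (differential M N f p v) (differential M N f p w)"


section \<open>Riemannian metrics\<close>

type_synonym ('a, 'e) bilinear_field = "'a \<Rightarrow> ('a, 'e) tvec \<Rightarrow> ('a, 'e) tvec \<Rightarrow> real"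

definition riemannian_metric ::
  "('a, 'e::euclidean_space) manifold \<Rightarrow> ('a, 'e) bilinear_field \<Rightarrow> bool" where
  "riemannian_metric M g \<longleftrightarrow>
     (\<forall>p\<in>points M. \<forall>u\<in>tangent_space M p. \<forall>v\<in>tangent_space M p.
        g p u v = g p v u \<and>
        (\<forall>w\<in>tangent_space M p. \<forall>a b. g p (a *\<^sub>R u + b *\<^sub>R v) w = a * g p u w + b * g p v w)) \<and>
     (\<forall>p\<in>points M. \<forall>v\<in>tangent_space M p. v \<noteq> 0 \<longrightarrow> g p v v > 0) \<and>
     (\<forall>c\<in>atlas M. \<forall>a b.
        smooth_on (snd c ` fst c)
          (\<lambda>x. g (chart_inv c x) (coord_vector M c (chart_inv c x) a)
                                 (coord_vector M c (chart_inv c x) b)))"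

definition C1_curve :: "('a, 'e::euclidean_space) manifold \<Rightarrow> (real \<Rightarrow> 'a) \<Rightarrow> bool" where
  "C1_curve M \<gamma> \<longleftrightarrow>
     continuous_map (top_of_set {0..1}) (mtop M) \<gamma> \<and>
     (\<forall>c\<in>atlas M.
        (\<forall>t\<in>{t \<in> {0..1}. \<gamma> t \<in> fst c}. (snd c \<circ> \<gamma>) differentiable (at t within {0..1})) \<and>
        continuous_on {t \<in> {0..1}. \<gamma> t \<in> fst c}
          (\<lambda>t. vector_derivative (snd c \<circ> \<gamma>) (at t within {0..1})))"

definition velocity ::
  "('a, 'e::euclidean_space) manifold \<Rightarrow> (real \<Rightarrow> 'a) \<Rightarrow> real \<Rightarrow> ('a, 'e) tvec" where
  "velocity M \<gamma> t =
     (\<lambda>c. if c \<in> charts_at M (\<gamma> t)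
          then vector_derivative (snd c \<circ> \<gamma>) (at t within {0..1}) else 0)"

definition curve_length ::
  "('a, 'e::euclidean_space) manifold \<Rightarrow> ('a, 'e) bilinear_field \<Rightarrow> (real \<Rightarrow> 'a) \<Rightarrow> real" where
  "curve_length M g \<gamma> =
     integral {0..1} (\<lambda>t. sqrt (g (\<gamma> t) (velocity M \<gamma> t) (velocity M \<gamma> t)))"

text \<open>Curves are not required to be regular, so a piecewise \<open>C\<^sup>1\<close> curve can be
  reparametrized to a \<open>C\<^sup>1\<close> curve of the same length (stopping at its corners), and the
  infimum is the usual one. The distance is only meaningful on connected manifolds; off the
  manifold it is set to \<open>0\<close>, as \<^locale>\<open>Metric_space\<close> constrains the distance there, too.\<close>

definition riemannian_dist ::
  "('a, 'e::euclidean_space) manifold \<Rightarrow> ('a, 'e) bilinear_field \<Rightarrow> 'a \<Rightarrow> 'a \<Rightarrow> real" where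
  "riemannian_dist M g p q =
     (if p \<in> points M \<and> q \<in> points M
      then Inf (curve_length M g ` {\<gamma>. C1_curve M \<gamma> \<and> \<gamma> 0 = p \<and> \<gamma> 1 = q}) else 0)"

definition riemannian_complete ::
  "('a, 'e::euclidean_space) manifold \<Rightarrow> ('a, 'e) bilinear_field \<Rightarrow> bool" where
  "riemannian_complete M g \<longleftrightarrow> Metric_space.mcomplete (points M) (riemannian_dist M g)"


section \<open>Oriented surfaces\<close>

type_synonym 'a surface = "('a, real^2) manifold"

text \<open>An oriented surface is given by an oriented atlas.\<close>

definition oriented_atlas :: "'a surface \<Rightarrow> bool" where
  "oriented_atlas M \<longleftrightarrow>
     (\<forall>c\<in>atlas M. \<forall>d\<in>atlas M. \<forall>x \<in> snd c ` (fst c \<inter> fst d).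
        det (matrix (frechet_derivative (transition c d) (at x))) > 0)"

definition oriented_riemannian_surface ::
  "'a surface \<Rightarrow> ('a, real^2) bilinear_field \<Rightarrow> bool" where
  "oriented_riemannian_surface M g \<longleftrightarrow>
     smooth_manifold M \<and> oriented_atlas M \<and> riemannian_metric M g"

definition positive_pair ::
  "'a surface \<Rightarrow> 'a \<Rightarrow> ('a, real^2) tvec \<Rightarrow> ('a, real^2) tvec \<Rightarrow> bool" where
  "positive_pair M p v w \<longleftrightarrow> (\<forall>c\<in>charts_at M p. det (vector [v c, w c] :: real^2^2) > 0)"

text \<open>Rotation by the angle \<open>+\<pi>/2\<close>.\<close>

definition rotation ::
  "'a surface \<Rightarrow> ('a, real^2) bilinear_field \<Rightarrow> 'a \<Rightarrow> ('a, real^2) tvec \<Rightarrow> ('a, real^2) tvec" where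
  "rotation M g p v =
     (THE w. w \<in> tangent_space M p \<and> g p v w = 0 \<and> g p w w = g p v v \<and>
             (v \<noteq> 0 \<longrightarrow> positive_pair M p v w))"

definition area_form ::
  "'a surface \<Rightarrow> ('a, real^2) bilinear_field \<Rightarrow> ('a, real^2) bilinear_field" where
  "area_form M g p v w = g p (rotation M g p v) w"


section \<open>Lagrangian immersions into a product of surfaces\<close>

definition product_form ::
  "'a surface \<Rightarrow> ('a, real^2) bilinear_field \<Rightarrow> 'b surface \<Rightarrow> ('b, real^2) bilinear_field \<Rightarrow>
   real \<Rightarrow> ('a \<times> 'b, (real^2) \<times> (real^2)) bilinear_field" where
  "product_form M1 g1 M2 g2 \<epsilon> q v w =
     pullback (product_manifold M1 M2) M1 fst (area_form M1 g1) q v w +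
     \<epsilon> * pullback (product_manifold M1 M2) M2 snd (area_form M2 g2) q v w"

definition lagrangian_immersion ::
  "'s surface \<Rightarrow> 'a surface \<Rightarrow> ('a, real^2) bilinear_field \<Rightarrow>
   'b surface \<Rightarrow> ('b, real^2) bilinear_field \<Rightarrow> real \<Rightarrow> ('s \<Rightarrow> 'a \<times> 'b) \<Rightarrow> bool" where
  "lagrangian_immersion S M1 g1 M2 g2 \<epsilon> \<Phi> \<longleftrightarrow>
     immersion S (product_manifold M1 M2) \<Phi> \<and>
     (\<forall>p\<in>points S. \<forall>v\<in>tangent_space S p. \<forall>w\<in>tangent_space S p.
        pullback S (product_manifold M1 M2) \<Phi> (product_form M1 g1 M2 g2 \<epsilon>) p v w = 0)"

definition projected_rank_zero_at ::
  "'s surface \<Rightarrow> 'a surface \<Rightarrow> 'b surface \<Rightarrow> ('s \<Rightarrow> 'a \<times> 'b) \<Rightarrow> 's \<Rightarrow> bool" where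
  "projected_rank_zero_at S M1 M2 \<Phi> p \<longleftrightarrow>
     rank_at S M1 (fst \<circ> \<Phi>) p = 0 \<or> rank_at S M2 (snd \<circ> \<Phi>) p = 0"

definition projected_rank_zero ::
  "'s surface \<Rightarrow> 'a surface \<Rightarrow> 'b surface \<Rightarrow> ('s \<Rightarrow> 'a \<times> 'b) \<Rightarrow> bool" where
  "projected_rank_zero S M1 M2 \<Phi> \<longleftrightarrow> (\<forall>p\<in>points S. projected_rank_zero_at S M1 M2 \<Phi> p)"

end

theory Submission
  imports Defs
begin

text \<open>Suppose that \<open>d\<phi> = 0\<close> at a point \<open>p\<close>. As \<open>\<Phi>\<close> is an immersion, \<open>d\<psi>\<close> is injective, hence an
  isomorphism between the tangent planes at \<open>p\<close> and \<open>\<psi>(p)\<close>. The form \<open>\<Phi>\<^sup>*\<Omega>\<close> reduces to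
  \<open>\<plusminus>\<psi>\<^sup>*\<omega>\<^sub>2\<close> at \<open>p\<close>, and this does not vanish since the area form is nondegenerate. The case
  \<open>d\<psi> = 0\<close> is symmetric.\<close>

text \<open>The argument is pointwise linear algebra; the work lies in matching the definitions. The
  immersion condition concerns d\<Phi> in product charts, the ranks concern the two components, and
  \<open>product_form\<close> pulls back along the projections. Two bridges connect them: composing
  d\<Phi> with the differential of a projection gives the differential of the component, and vectors
  with equal component differentials have equal images under d\<Phi>. The second obstacle is
  nondegeneracy. As \<open>rotation\<close> is a definite description, nothing is known about it
  until existence and uniqueness of the rotated vector are proved; v then pairs with its own
  rotation to g(v,v) > 0. Equal dimensions are what makes an injective differential onto, so that
  this partner is an image, too.\<close>

section \<open>Derivatives in charts\<close>

lemma chart_inv_chart: "inj_on (snd c) (fst c) \<Longrightarrow> p \<in> fst c \<Longrightarrow> chart_inv c (snd c p) = p"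
  by (simp add: chart_inv_def)

lemma chart_chart_inv:
  assumes "x \<in> snd c ` fst c"
  shows "chart_inv c x \<in> fst c" "snd c (chart_inv c x) = x"
  using assms by (simp_all add: chart_inv_def inv_into_into f_inv_into_f)

lemma charts_at_nonempty: "smooth_manifold M \<Longrightarrow> p \<in> points M \<Longrightarrow> charts_at M p \<noteq> {}"
  unfolding smooth_manifold_def charts_at_def by blast

lemma some_chart: "charts_at M p \<noteq> {} \<Longrightarrow> (SOME c. c \<in> charts_at M p) \<in> charts_at M p"
  by (simp add: some_in_eq)

lemma continuous_map_points:
  "continuous_map (mtop M) (mtop N) f \<Longrightarrow> p \<in> points M \<Longrightarrow> f p \<in> points N"
  by (auto simp: points_def continuous_map_def)

lemma smooth_manifold_chart:
  assumes "smooth_manifold M" "c \<in> charts_at M p"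
  shows "c \<in> atlas M" "p \<in> fst c" "openin (mtop M) (fst c)" "open (snd c ` fst c)"
    "inj_on (snd c) (fst c)"
    "homeomorphic_map (subtopology (mtop M) (fst c)) (top_of_set (snd c ` fst c)) (snd c)"
proof -
  show c: "c \<in> atlas M" "p \<in> fst c"
    using assms(2) by (auto simp: charts_at_def)
  show o: "openin (mtop M) (fst c)" and "open (snd c ` fst c)"
    and h: "homeomorphic_map (subtopology (mtop M) (fst c)) (top_of_set (snd c ` fst c)) (snd c)"
    using assms(1) c(1) unfolding smooth_manifold_def by blast+
  have "topspace (subtopology (mtop M) (fst c)) = fst c"
    using openin_subset[OF o] by auto
  then show "inj_on (snd c) (fst c)"
    using homeomorphic_imp_injective_map[OF h] by simp
qed

text \<open>Continuity of the inverse chart at \<open>snd c p\<close>, phrased for an abstract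
  topology. The chart maps \<open>fst c \<inter> U\<close> to a set that is open in the chart image
  and hence in the model space.\<close>

lemma eventually_chart_inv:
  assumes M: "smooth_manifold M" and c: "c \<in> charts_at M p"
    and U: "openin (mtop M) U" "p \<in> U"
  shows "eventually (\<lambda>x. chart_inv c x \<in> U) (nhds (snd c p))"
proof -
  note C = smooth_manifold_chart[OF M c]
  have "openin (subtopology (mtop M) (fst c)) (fst c \<inter> U)"
    using U(1) by (metis inf_commute openin_subtopology_Int)
  then have "openin (top_of_set (snd c ` fst c)) (snd c ` (fst c \<inter> U))"
    using homeomorphic_imp_open_map[OF C(6)] by (auto simp: open_map_def)
  then have "open (snd c ` (fst c \<inter> U))"
    using C(4) by (simp add: openin_open_eq)
  moreover have "snd c p \<in> snd c ` (fst c \<inter> U)"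
    using C(2) U(2) by blast
  moreover have "chart_inv c x \<in> U" if "x \<in> snd c ` (fst c \<inter> U)" for x
    using that chart_inv_chart[OF C(5)] by auto
  ultimately show ?thesis
    unfolding eventually_nhds by blast
qed

text \<open>The chain rule for \<open>k \<circ> F\<close> after inserting
  \<open>chart_inv c \<circ> snd c\<close> in the middle. The insertion is harmless only where F
  stays in the chart domain, whence the neighbourhood hypothesis.\<close>

lemma frechet_derivative_through_chart:
  assumes inj: "inj_on (snd c) (fst c)"
    and ev: "eventually (\<lambda>y. F y \<in> fst c) (nhds x)"
    and D1: "(snd c \<circ> F) differentiable (at x)"
    and D2: "(k \<circ> chart_inv c) differentiable (at (snd c (F x)))"
  shows "frechet_derivative (k \<circ> F) (at x) =
     frechet_derivative (k \<circ> chart_inv c) (at (snd c (F x))) \<circ> frechet_derivative (snd c \<circ> F) (at x)"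
proof -
  let ?A = "frechet_derivative (k \<circ> chart_inv c) (at (snd c (F x)))"
  let ?B = "frechet_derivative (snd c \<circ> F) (at x)"
  have "((snd c \<circ> F) has_derivative ?B) (at x)"
    using D1 frechet_derivative_works by blast
  moreover have "((k \<circ> chart_inv c) has_derivative ?A) (at ((snd c \<circ> F) x))"
    using D2 unfolding frechet_derivative_works by (simp only: comp_apply)
  ultimately have H: "((k \<circ> chart_inv c) \<circ> (snd c \<circ> F) has_derivative ?A \<circ> ?B) (at x)"
    by (rule diff_chain_at)
  have E: "((k \<circ> chart_inv c) \<circ> (snd c \<circ> F)) y = (k \<circ> F) y" if "F y \<in> fst c" for y
    using chart_inv_chart[OF inj that] by simp
  have "eventually (\<lambda>y. ((k \<circ> chart_inv c) \<circ> (snd c \<circ> F)) y = (k \<circ> F) y) (at x)"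
    using ev E by (auto simp: eventually_at_filter elim: eventually_mono)
  \<comment> \<open>The filter \<open>at x\<close> omits x itself, so agreement there is supplied
    separately.\<close>
  moreover have "((k \<circ> chart_inv c) \<circ> (snd c \<circ> F)) x = (k \<circ> F) x"
    using E eventually_nhds_x_imp_x[OF ev] by blast
  ultimately have "(k \<circ> F has_derivative ?A \<circ> ?B) (at x)"
    using has_derivative_transform_eventually[OF H] by blast
  then show ?thesis
    by (rule frechet_derivative_at[symmetric])
qed

lemma smooth_on_differentiable: "smooth_on U f \<Longrightarrow> x \<in> U \<Longrightarrow> f differentiable (at x)"
  unfolding smooth_on_def by (metis Ck_on.simps(2))

lemma transition_differentiable:
  assumes "smooth_manifold M" "c \<in> charts_at M p" "d \<in> charts_at M p"
  shows "transition c d differentiable (at (snd c p))"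
proof (rule smooth_on_differentiable)
  show "smooth_on (snd c ` (fst c \<inter> fst d)) (transition c d)"
    using assms unfolding smooth_manifold_def charts_at_def by blast
  show "snd c p \<in> snd c ` (fst c \<inter> fst d)"
    using assms by (auto simp: charts_at_def)
qed

text \<open>What the chain rule needs at a single point; weaker than \<open>smooth_map\<close>, so
  that projections and components need no proof of smoothness. All charts are covered because
  \<open>differential\<close> picks its source chart by \<open>SOME\<close> and has a value in every
  target chart.\<close>

definition differentiable_in_charts ::
  "('a, 'e::euclidean_space) manifold \<Rightarrow> ('b, 'f::euclidean_space) manifold \<Rightarrow> ('a \<Rightarrow> 'b) \<Rightarrow>
   'a \<Rightarrow> bool" where
  "differentiable_in_charts M N f p \<longleftrightarrow>
     (\<forall>c\<in>charts_at M p. \<forall>d\<in>charts_at N (f p).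
        (snd d \<circ> f \<circ> chart_inv c) differentiable (at (snd c p)))"

lemma smooth_map_differentiable_in_charts:
  assumes "smooth_map M N f"
  shows "differentiable_in_charts M N f p"
  unfolding differentiable_in_charts_def
proof (intro ballI)
  fix c d assume c: "c \<in> charts_at M p" "d \<in> charts_at N (f p)"
  then have "smooth_on (snd c ` {p \<in> fst c. f p \<in> fst d}) (snd d \<circ> f \<circ> chart_inv c)"
    using assms unfolding smooth_map_def charts_at_def by blast
  then show "(snd d \<circ> f \<circ> chart_inv c) differentiable (at (snd c p))"
    by (rule smooth_on_differentiable) (use c in \<open>auto simp: charts_at_def\<close>)
qed

lemma transition_chain:
  assumes M: "smooth_manifold M" and c: "c \<in> charts_at M p" "d \<in> charts_at M p" "e \<in> charts_at M p"
  shows "frechet_derivative (transition d e) (at (snd d p)) (frechet_derivative (transition c d) (at (snd c p)) a)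
     = frechet_derivative (transition c e) (at (snd c p)) a"
proof -
  note C = smooth_manifold_chart[OF M c(1)] and D = smooth_manifold_chart[OF M c(2)]
  have p: "chart_inv c (snd c p) = p"
    by (rule chart_inv_chart[OF C(5,2)])
  have "frechet_derivative (snd e \<circ> chart_inv c) (at (snd c p)) =
     frechet_derivative (snd e \<circ> chart_inv d) (at (snd d (chart_inv c (snd c p)))) \<circ>
     frechet_derivative (snd d \<circ> chart_inv c) (at (snd c p))"
    using transition_differentiable[OF M c(1,2)] transition_differentiable[OF M c(2,3)] p
    by (intro frechet_derivative_through_chart D eventually_chart_inv[OF M c(1)])
       (auto simp: transition_def)
  then show ?thesis
    by (simp add: transition_def p)
qed

text \<open>\<open>transition c c\<close> is the identity only on the chart image, but this is an
  open neighbourhood of \<open>snd c p\<close>.\<close>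

lemma transition_same:
  assumes M: "smooth_manifold M" and c: "c \<in> charts_at M p"
  shows "frechet_derivative (transition c c) (at (snd c p)) a = a"
proof -
  note C = smooth_manifold_chart[OF M c]
  have "((\<lambda>x. x) has_derivative (\<lambda>x. x)) (at (snd c p))"
    by simp
  then have "(transition c c has_derivative (\<lambda>x. x)) (at (snd c p))"
    by (rule has_derivative_transform_within_open[OF _ C(4)])
       (use C(2) chart_chart_inv(2)[of _ c] in \<open>auto simp: transition_def\<close>)
  then show ?thesis
    using frechet_derivative_at by metis
qed


section \<open>Tangent spaces\<close>

lemma coord_vector_in_tangent_space:
  assumes "smooth_manifold M" "c \<in> charts_at M p"
  shows "coord_vector M c p a \<in> tangent_space M p"
  unfolding tangent_space_def coord_vector_def
  using transition_chain[OF assms] by auto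

text \<open>Together with \<open>coord_vector_in_tangent_space\<close> and
  \<open>tangent_space_eqI\<close>, this makes evaluation in one chart a bijection from the tangent
  space to the model space.\<close>

lemma coord_vector_same:
  assumes "smooth_manifold M" "c \<in> charts_at M p"
  shows "coord_vector M c p a c = a"
  using transition_same[OF assms] assms(2) by (simp add: coord_vector_def)

lemma tangent_space_chart:
  assumes "v \<in> tangent_space M p" "c \<in> charts_at M p" "d \<in> charts_at M p"
  shows "v d = frechet_derivative (transition c d) (at (snd c p)) (v c)"
  using assms unfolding tangent_space_def by blast

lemma tangent_space_off_charts: "v \<in> tangent_space M p \<Longrightarrow> c \<notin> charts_at M p \<Longrightarrow> v c = 0"
  unfolding tangent_space_def by blast

lemma tangent_spaceI:
  assumes "\<And>c. c \<notin> charts_at M p \<Longrightarrow> v c = 0"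
    and "\<And>c d. c \<in> charts_at M p \<Longrightarrow> d \<in> charts_at M p \<Longrightarrow>
      v d = frechet_derivative (transition c d) (at (snd c p)) (v c)"
  shows "v \<in> tangent_space M p"
  using assms unfolding tangent_space_def by blast

text \<open>Compatibility propagates the value in one chart to all charts at p, and the convention
  of value 0 settles the rest.\<close>

lemma tangent_space_eqI:
  assumes c: "c \<in> charts_at M p" and v: "v \<in> tangent_space M p" "w \<in> tangent_space M p"
    and eq: "v c = w c"
  shows "v = w"
proof
  fix d show "v d = w d"
  proof (cases "d \<in> charts_at M p")
    case True
    show ?thesis
      unfolding tangent_space_chart[OF v(1) c True] tangent_space_chart[OF v(2) c True] eq ..
  next
    case False
    show ?thesis
      unfolding tangent_space_off_charts[OF v(1) False] tangent_space_off_charts[OF v(2) False] ..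
  qed
qed

lemma subspace_tangent_space:
  assumes "smooth_manifold M"
  shows "subspace (tangent_space M p)"
proof (rule subspaceI)
  have L: "linear (frechet_derivative (transition c d) (at (snd c p)))"
    if "c \<in> charts_at M p" "d \<in> charts_at M p" for c d
    using transition_differentiable[OF assms that] by (rule linear_frechet_derivative)
  show "0 \<in> tangent_space M p"
    by (rule tangent_spaceI) (simp_all add: linear_0[OF L])
  show "v + w \<in> tangent_space M p" if v: "v \<in> tangent_space M p" "w \<in> tangent_space M p" for v w
  proof (rule tangent_spaceI)
    fix c d assume cd: "c \<in> charts_at M p" "d \<in> charts_at M p"
    show "(v + w) d = frechet_derivative (transition c d) (at (snd c p)) ((v + w) c)"
      unfolding plus_fun_apply linear_add[OF L[OF cd]]
        tangent_space_chart[OF v(1) cd, symmetric] tangent_space_chart[OF v(2) cd, symmetric] ..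
  qed (simp add: tangent_space_off_charts[OF v(1)] tangent_space_off_charts[OF v(2)])
  show "r *\<^sub>R v \<in> tangent_space M p" if v: "v \<in> tangent_space M p" for r v
  proof (rule tangent_spaceI)
    fix c d assume cd: "c \<in> charts_at M p" "d \<in> charts_at M p"
    show "(r *\<^sub>R v) d = frechet_derivative (transition c d) (at (snd c p)) ((r *\<^sub>R v) c)"
      unfolding scaleR_fun_def linear_scale[OF L[OF cd]] tangent_space_chart[OF v cd, symmetric] ..
  qed (simp add: scaleR_fun_def tangent_space_off_charts[OF v])
qed


section \<open>Differentials\<close>

text \<open>The chart hypothesis on \<open>N\<close> is spelled out because the lemma is applied to a product, which is
  not shown to be a smooth manifold.\<close>

lemma differential_comp:
  assumes M: "smooth_manifold M" "p \<in> points M"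
    and N: "\<And>c. c \<in> charts_at N (f p) \<Longrightarrow> openin (mtop N) (fst c) \<and> inj_on (snd c) (fst c)"
      "charts_at N (f p) \<noteq> {}"
    and f: "continuous_map (mtop M) (mtop N) f" "differentiable_in_charts M N f p"
    and h: "differentiable_in_charts N K h (f p)"
  shows "differential N K h (f p) (differential M N f p v) = differential M K (h \<circ> f) p v"
proof -
  define s where "s = (SOME c. c \<in> charts_at M p)"
  \<comment> \<open>This is the chart in which \<open>differential N K h\<close> reads its argument,
    so the chain rule is routed through it.\<close>
  define c where "c = (SOME c. c \<in> charts_at N (f p))"
  have s: "s \<in> charts_at M p"
    unfolding s_def by (rule some_chart[OF charts_at_nonempty[OF M]])
  have c: "c \<in> charts_at N (f p)"
    unfolding c_def by (rule some_chart[OF N(2)])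
  have p: "chart_inv s (snd s p) = p"
    by (rule chart_inv_chart[OF smooth_manifold_chart(5,2)[OF M(1) s]])
  have ev: "eventually (\<lambda>x. chart_inv s x \<in> {q \<in> topspace (mtop M). f q \<in> fst c}) (nhds (snd s p))"
  proof (rule eventually_chart_inv[OF M(1) s])
    show "openin (mtop M) {q \<in> topspace (mtop M). f q \<in> fst c}"
      using N(1)[OF c] by (intro openin_continuous_map_preimage[OF f(1)]) blast
    show "p \<in> {q \<in> topspace (mtop M). f q \<in> fst c}"
      using M(2) c by (simp add: points_def charts_at_def)
  qed
  show ?thesis
  proof
    fix d
    show "differential N K h (f p) (differential M N f p v) d = differential M K (h \<circ> f) p v d"
    proof (cases "d \<in> charts_at K (h (f p))")
      case d: True
      have "frechet_derivative ((snd d \<circ> h) \<circ> (f \<circ> chart_inv s)) (at (snd s p)) =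
         frechet_derivative ((snd d \<circ> h) \<circ> chart_inv c) (at (snd c ((f \<circ> chart_inv s) (snd s p)))) \<circ>
         frechet_derivative (snd c \<circ> (f \<circ> chart_inv s)) (at (snd s p))"
      proof (rule frechet_derivative_through_chart)
        show "inj_on (snd c) (fst c)"
          using N(1)[OF c] ..
        show "\<forall>\<^sub>F y in nhds (snd s p). (f \<circ> chart_inv s) y \<in> fst c"
          using ev by (rule eventually_mono) auto
        show "snd c \<circ> (f \<circ> chart_inv s) differentiable at (snd s p)"
          using f(2) s c unfolding differentiable_in_charts_def by (simp add: comp_assoc)
        show "snd d \<circ> h \<circ> chart_inv c differentiable at (snd c ((f \<circ> chart_inv s) (snd s p)))"
          using h c d p unfolding differentiable_in_charts_def by simp
      qed
      then show ?thesis
        using d c p by (simp add: differential_def Let_def s_def[symmetric] c_def[symmetric] comp_assoc)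
    qed (simp add: differential_def Let_def)
  qed
qed

text \<open>By \<open>differential_comp\<close>, composing with the differential of
  \<open>id\<close> changes nothing. But that differential rebuilds a family from its value in one
  chart, so the result is a \<open>coord_vector\<close> and hence tangent.\<close>

lemma differential_in_tangent_space:
  assumes M: "smooth_manifold M" "p \<in> points M" and N: "smooth_manifold N"
    and f: "continuous_map (mtop M) (mtop N) f" "differentiable_in_charts M N f p"
  shows "differential M N f p v \<in> tangent_space N (f p)"
proof -
  have q: "f p \<in> points N"
    by (rule continuous_map_points[OF f(1) M(2)])
  have id: "differentiable_in_charts N N id (f p)"
    using transition_differentiable[OF N] by (auto simp: differentiable_in_charts_def transition_def)
  have charts: "openin (mtop N) (fst c) \<and> inj_on (snd c) (fst c)" if "c \<in> charts_at N (f p)" for c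
    using smooth_manifold_chart(3,5)[OF N that] ..
  let ?u = "differential M N f p v" and ?c = "SOME c. c \<in> charts_at N (f p)"
  have "?u = differential N N id (f p) ?u"
    using differential_comp[OF M charts charts_at_nonempty[OF N q] f id, of v] by (simp only: id_comp)
  also have "\<dots> = coord_vector N ?c (f p) (?u ?c)"
    unfolding differential_def[of N N] Let_def coord_vector_def transition_def id_apply comp_id ..
  also have "\<dots> \<in> tangent_space N (f p)"
    by (rule coord_vector_in_tangent_space[OF N some_chart[OF charts_at_nonempty[OF N q]]])
  finally show ?thesis .
qed

text \<open>Unlike \<open>differential\<close> itself, this factorization through one chart makes linearity and finite
  rank visible.\<close>

lemma differential_factor:
  assumes M: "smooth_manifold M" "p \<in> points M" and f: "differentiable_in_charts M N f p"
  obtains c H where "c \<in> charts_at M p" "linear H" "\<And>v. differential M N f p v = H (v c)"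
proof
  let ?c = "SOME c. c \<in> charts_at M p"
  let ?H = "\<lambda>a d. if d \<in> charts_at N (f p)
      then frechet_derivative (snd d \<circ> f \<circ> chart_inv ?c) (at (snd ?c p)) a else 0"
  show c: "?c \<in> charts_at M p"
    by (rule some_chart[OF charts_at_nonempty[OF M]])
  have "linear (frechet_derivative (snd d \<circ> f \<circ> chart_inv ?c) (at (snd ?c p)))"
    if "d \<in> charts_at N (f p)" for d
    using f c that unfolding differentiable_in_charts_def by (blast intro: linear_frechet_derivative)
  then show "linear ?H"
    by (intro linearI) (auto simp: fun_eq_iff linear_add linear_scale scaleR_fun_def)
  show "differential M N f p v = ?H (v ?c)" for v
    by (simp add: differential_def Let_def)
qed

text \<open>On an infinite-dimensional space \<open>dim\<close> would be the junk value \<open>0\<close>, so finite dimensionality of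
  the image has to enter.\<close>

lemma rank_at_eq_0:
  assumes "smooth_manifold M" "p \<in> points M" "differentiable_in_charts M N f p"
    and rank: "rank_at M N f p = 0" and v: "v \<in> tangent_space M p"
  shows "differential M N f p v = 0"
proof -
  obtain c H where H: "linear H" "\<And>v. differential M N f p v = H (v c)"
    using differential_factor[OF assms(1-3)] by metis
  let ?V = "differential M N f p ` tangent_space M p"
  have "?V \<subseteq> H ` span Basis"
    using H(2) by auto
  also have "\<dots> = span (H ` Basis)"
    using linear_span_image[OF H(1)] by simp
  finally have V: "?V \<subseteq> span (H ` Basis)" .
  obtain B where B: "B \<subseteq> ?V" "independent B" "?V \<subseteq> span B" "card B = dim ?V"
    by (rule basis_exists)
  have "finite B"
    using independent_span_bound[of "H ` Basis" B] B(1,2) V by auto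
  then have "B = {}"
    using B(4) rank by (simp add: rank_at_def)
  then show ?thesis
    using B(3) v by auto
qed

text \<open>Both manifolds share the model space \<open>'e\<close>, so in charts the differential is
  an injective endomorphism of a finite-dimensional space.\<close>

lemma differential_onto:
  fixes M :: "('a, 'e::euclidean_space) manifold" and N :: "('b, 'e) manifold"
  assumes M: "smooth_manifold M" "p \<in> points M" and N: "smooth_manifold N"
    and f: "continuous_map (mtop M) (mtop N) f" "differentiable_in_charts M N f p"
    and inj: "inj_on (differential M N f p) (tangent_space M p)"
  shows "differential M N f p ` tangent_space M p = tangent_space N (f p)"
proof -
  have q: "f p \<in> points N"
    by (rule continuous_map_points[OF f(1) M(2)])
  obtain c H where c: "c \<in> charts_at M p" and H: "linear H" "\<And>v. differential M N f p v = H (v c)"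
    using differential_factor[OF M f(2)] by metis
  obtain d where d: "d \<in> charts_at N (f p)"
    using charts_at_nonempty[OF N q] by blast
  note T = coord_vector_in_tangent_space[OF M(1) c] and S = coord_vector_same[OF M(1) c]
  note into = differential_in_tangent_space[OF M N f]
  have D: "differential M N f p (coord_vector M c p a) = H a" for a
    by (simp add: H(2) S)
  have "linear (\<lambda>a. H a d)"
    using H(1) by (intro linearI) (simp_all add: linear_add linear_scale scaleR_fun_def)
  moreover have "inj (\<lambda>a. H a d)"
  proof (rule injI)
    fix a b assume "H a d = H b d"
    then have "differential M N f p (coord_vector M c p a) = differential M N f p (coord_vector M c p b)"
      by (intro tangent_space_eqI[OF d into into]) (simp add: D)
    then have "coord_vector M c p a = coord_vector M c p b"
      using inj T by (auto dest: inj_onD)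
    then show "a = b"
      using S by metis
  qed
  ultimately have surj: "surj (\<lambda>a. H a d)"
    by (rule linear_injective_imp_surjective) simp
  have "w \<in> differential M N f p ` tangent_space M p" if w: "w \<in> tangent_space N (f p)" for w
  proof -
    obtain a where "w d = H a d"
      using surj by (metis surjD)
    then have "w = differential M N f p (coord_vector M c p a)"
      by (intro tangent_space_eqI[OF d w into]) (simp add: D)
    then show ?thesis
      using T by blast
  qed
  then show ?thesis
    using into by blast
qed


section \<open>The area form\<close>

lemma metric_on_tangent_space:
  assumes "riemannian_metric M g" "p \<in> points M"
  shows "u \<in> tangent_space M p \<Longrightarrow> v \<in> tangent_space M p \<Longrightarrow> g p u v = g p v u"
    and "\<lbrakk>u \<in> tangent_space M p; v \<in> tangent_space M p; w \<in> tangent_space M p\<rbrakk>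
      \<Longrightarrow> g p (a *\<^sub>R u + b *\<^sub>R v) w = a * g p u w + b * g p v w"
    and "v \<in> tangent_space M p \<Longrightarrow> v \<noteq> 0 \<Longrightarrow> g p v v > 0"
proof -
  have g: "\<forall>u\<in>tangent_space M p. \<forall>v\<in>tangent_space M p. g p u v = g p v u \<and>
      (\<forall>w\<in>tangent_space M p. \<forall>a b. g p (a *\<^sub>R u + b *\<^sub>R v) w = a * g p u w + b * g p v w)"
    "\<forall>v\<in>tangent_space M p. v \<noteq> 0 \<longrightarrow> g p v v > 0"
    using assms unfolding riemannian_metric_def by simp_all
  show "u \<in> tangent_space M p \<Longrightarrow> v \<in> tangent_space M p \<Longrightarrow> g p u v = g p v u"
    and "\<lbrakk>u \<in> tangent_space M p; v \<in> tangent_space M p; w \<in> tangent_space M p\<rbrakk>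
      \<Longrightarrow> g p (a *\<^sub>R u + b *\<^sub>R v) w = a * g p u w + b * g p v w"
    and "v \<in> tangent_space M p \<Longrightarrow> v \<noteq> 0 \<Longrightarrow> g p v v > 0"
    using g by simp_all
qed

section \<open>Orientation and determinants in the plane\<close>

lemma det_vector2: "det (vector [v, w] :: real^2^2) = v$1 * w$2 - v$2 * w$1"
  by (simp add: det_2)

text \<open>The vectors are the rows of the matrix, so this is multiplicativity of the determinant
  up to transposition, checked by entries.\<close>

lemma det_linear_image2:
  fixes L :: "real^2 \<Rightarrow> real^2"
  assumes "linear L"
  shows "det (vector [L v, L w] :: real^2^2) = det (matrix L) * det (vector [v, w] :: real^2^2)"
proof -
  have "L x = matrix L *v x" for x
    using assms by (simp add: matrix_works)
  then have "L x $ i = matrix L $ i $ 1 * x $ 1 + matrix L $ i $ 2 * x $ 2" for x i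
    by (simp add: matrix_vector_mult_def sum_2)
  then show ?thesis
    by (simp add: det_vector2 det_2) (simp add: algebra_simps)
qed

text \<open>Transition maps have positive Jacobian determinant, so the sign tested in one chart is
  the sign in all of them.\<close>

lemma positive_pair_chart:
  assumes M: "smooth_manifold M" "oriented_atlas M" and c: "c \<in> charts_at M p"
    and v: "v \<in> tangent_space M p" "w \<in> tangent_space M p"
  shows "positive_pair M p v w \<longleftrightarrow> det (vector [v c, w c] :: real^2^2) > 0"
proof
  assume *: "det (vector [v c, w c] :: real^2^2) > 0"
  show "positive_pair M p v w"
    unfolding positive_pair_def
  proof
    fix d assume d: "d \<in> charts_at M p"
    let ?L = "frechet_derivative (transition c d) (at (snd c p))"
    have "linear ?L"
      using transition_differentiable[OF M(1) c d] by (rule linear_frechet_derivative)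
    moreover have "det (matrix ?L) > 0"
      using M(2) c d unfolding oriented_atlas_def charts_at_def by blast
    moreover have "v d = ?L (v c)" "w d = ?L (w c)"
      by (rule tangent_space_chart[OF v(1) c d], rule tangent_space_chart[OF v(2) c d])
    ultimately show "det (vector [v d, w d] :: real^2^2) > 0"
      using * det_linear_image2 by simp
  qed
qed (use c in \<open>auto simp: positive_pair_def\<close>)

text \<open>For the zero vector the orientation clause is void, and length zero alone singles out
  the description. The case matters because a vanishing differential feeds 0 into the area
  form.\<close>

lemma rotation_0:
  assumes "oriented_riemannian_surface M g" "p \<in> points M"
  shows "rotation M g p 0 = 0"
proof -
  have M: "smooth_manifold M" "riemannian_metric M g"
    using assms by (simp_all add: oriented_riemannian_surface_def)
  note g = metric_on_tangent_space[OF M(2) assms(2)]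
  have 0: "0 \<in> tangent_space M p"
    using subspace_0[OF subspace_tangent_space[OF M(1)]] .
  have "g p 0 0 = 0"
    using g(2)[OF 0 0 0, of 0 0] by simp
  moreover have "w = 0" if "w \<in> tangent_space M p" "g p w w = 0" for w
    using g(3)[OF that(1)] that(2) by fastforce
  ultimately show ?thesis
    unfolding rotation_def using 0 by (intro the_equality) simp_all
qed

text \<open>Both claims are read off the definite description once it is shown to denote. Existence:
  turn v in a chart, make the result orthogonal to v and rescale it. Uniqueness: split a competitor
  along the vector found and v.\<close>

lemma rotation_works:
  assumes "oriented_riemannian_surface M g" "p \<in> points M"
    and v: "v \<in> tangent_space M p" "v \<noteq> 0"
  shows "rotation M g p v \<in> tangent_space M p"
    and "g p (rotation M g p v) (rotation M g p v) = g p v v"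
proof -
  have M: "smooth_manifold M" "oriented_atlas M" "riemannian_metric M g"
    using assms(1) by (simp_all add: oriented_riemannian_surface_def)
  obtain c where c: "c \<in> charts_at M p"
    using charts_at_nonempty[OF M(1) assms(2)] by blast
  let ?T = "tangent_space M p"
  let ?G = "g p"
  note T = subspace_tangent_space[OF M(1), of p]
  note sym = metric_on_tangent_space(1)[OF M(3) assms(2)]
    and lin = metric_on_tangent_space(2)[OF M(3) assms(2)]
    and pos = metric_on_tangent_space(3)[OF M(3) assms(2)]
  have comb: "a *\<^sub>R u + b *\<^sub>R w \<in> ?T" if "u \<in> ?T" "w \<in> ?T" for a b u w
    using that T by (simp add: subspace_add subspace_scale)
  have lin': "?G w (a *\<^sub>R x + b *\<^sub>R y) = a * ?G w x + b * ?G w y"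
    if "x \<in> ?T" "y \<in> ?T" "w \<in> ?T" for a b x y w
  proof -
    have "?G w (a *\<^sub>R x + b *\<^sub>R y) = ?G (a *\<^sub>R x + b *\<^sub>R y) w"
      by (rule sym[OF that(3) comb[OF that(1,2)]])
    also have "\<dots> = a * ?G x w + b * ?G y w"
      by (rule lin[OF that])
    finally show ?thesis
      unfolding sym[OF that(3,1)] sym[OF that(3,2)] .
  qed
  define A where "A u w = det (vector [u c, w c] :: real^2^2)" for u w
  have A_comb: "A v (a *\<^sub>R v + b *\<^sub>R w) = b * A v w" for a b w
    by (simp add: A_def det_vector2 scaleR_fun_def algebra_simps)
  have A_pos: "positive_pair M p v w \<longleftrightarrow> A v w > 0" if "w \<in> ?T" for w
    unfolding A_def by (rule positive_pair_chart[OF M(1,2) c v(1) that])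
  have vc: "v c \<noteq> 0"
    using tangent_space_eqI[OF c v(1) subspace_0[OF T]] v(2) by auto
  have v_pos: "?G v v > 0"
    using pos v by blast
  \<comment> \<open>The Euclidean quarter turn of v in the chart c: in general not orthogonal to v
    for g, but on its positive side.\<close>
  define u where "u = coord_vector M c p (vector [- (v c $ 2), v c $ 1])"
  have u: "u \<in> ?T"
    unfolding u_def by (rule coord_vector_in_tangent_space[OF M(1) c])
  have "A v u = (v c $ 1)\<^sup>2 + (v c $ 2)\<^sup>2"
    unfolding A_def u_def coord_vector_same[OF M(1) c] by (simp add: det_vector2 power2_eq_square)
  moreover have "(v c $ 1)\<^sup>2 + (v c $ 2)\<^sup>2 \<noteq> 0"
    using vc by (simp add: vec_eq_iff forall_2 sum_power2_eq_zero_iff)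
  ultimately have Au: "A v u > 0"
    by (metis sum_power2_ge_zero less_le)
  \<comment> \<open>Gram-Schmidt: subtracting a multiple of v does not change the determinant with
    v. The coefficient 1, like the 0 in \<open>?w\<close> below, fits the two-term linearity
    rule.\<close>
  define n where "n = (- (?G v u / ?G v v)) *\<^sub>R v + 1 *\<^sub>R u"
  have n: "n \<in> ?T"
    unfolding n_def by (rule comb[OF v(1) u])
  have An: "A v n > 0"
    using Au unfolding n_def A_comb by simp
  have vn: "?G v n = 0"
    unfolding n_def lin'[OF v(1) u v(1)] using v_pos by simp
  have "n \<noteq> 0"
    using An by (auto simp: A_def det_vector2)
  then have n_pos: "?G n n > 0"
    using pos n by blast
  \<comment> \<open>The factor that gives n the length of v.\<close>
  define r where "r = sqrt (?G v v / ?G n n)"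
  have r: "r > 0" "r * r = ?G v v / ?G n n"
    unfolding r_def using v_pos n_pos by (simp_all flip: power2_eq_square)
  define P where "P w \<longleftrightarrow> w \<in> ?T \<and> ?G v w = 0 \<and> ?G w w = ?G v v \<and> (v \<noteq> 0 \<longrightarrow> positive_pair M p v w)" for w
  let ?w = "0 *\<^sub>R v + r *\<^sub>R n"
  have w: "?w \<in> ?T"
    by (rule comb[OF v(1) n])
  have "?G v ?w = 0"
    unfolding lin'[OF v(1) n v(1)] by (simp add: vn)
  moreover have "?G ?w ?w = ?G v v"
    unfolding lin'[OF v(1) n w] using lin[OF v(1) n n, of 0 r] r(2) n_pos
    by (simp add: mult.assoc[symmetric])
  moreover have "A v ?w > 0"
    unfolding A_comb using r An by simp
  ultimately have "P ?w"
    using w A_pos by (simp add: P_def)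
  moreover have "x = ?w" if "P x" for x
  proof -
    have x: "x \<in> ?T" "?G v x = 0" "?G x x = ?G v v" "A v x > 0"
      using that v(2) A_pos by (auto simp: P_def)
    \<comment> \<open>Chosen so that x - b n has determinant 0 with v. It is then a multiple of v,
      and being orthogonal to v, it is 0.\<close>
    define b where "b = A v x / A v n"
    define y where "y = 1 *\<^sub>R x + (- b) *\<^sub>R n"
    have y: "y \<in> ?T"
      unfolding y_def by (rule comb[OF x(1) n])
    have "A v y = A v x - b * A v n"
      by (simp add: A_def y_def det_vector2 scaleR_fun_def algebra_simps)
    then have Ay: "A v y = 0"
      using An by (simp add: b_def)
    have vy: "?G v y = 0"
      unfolding y_def lin'[OF x(1) n v(1)] by (simp add: x vn)
    \<comment> \<open>The factor is a quotient of coordinates, taken where \<open>v c\<close> has a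
      nonzero one.\<close>
    obtain a where "y c = a *\<^sub>R v c"
    proof (cases "v c $ 1 = 0")
      case True
      then have "v c $ 2 \<noteq> 0"
        using vc by (auto simp: vec_eq_iff forall_2)
      then show ?thesis
        using that[of "y c $ 2 / v c $ 2"] Ay True
        by (simp add: A_def det_vector2 vec_eq_iff forall_2)
    next
      case False
      then show ?thesis
        using that[of "y c $ 1 / v c $ 1"] Ay
        by (simp add: A_def det_vector2 vec_eq_iff forall_2 field_simps)
    qed
    then have "y = a *\<^sub>R v"
      by (intro tangent_space_eqI[OF c y subspace_scale[OF T v(1)]]) (simp add: scaleR_fun_def)
    then have "a * ?G v v = 0"
      using vy lin'[OF v(1) v(1) v(1), of a 0] by simp
    then have "y = 0"
      using v_pos \<open>y = a *\<^sub>R v\<close> by simp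
    then have xb: "x = 0 *\<^sub>R v + b *\<^sub>R n"
      by (simp add: y_def)
    then have "?G x x = b * (b * ?G n n)"
      using lin[OF v(1) n n, of 0 b] lin'[OF v(1) n x(1), of 0 b] by simp
    then have "b\<^sup>2 = r\<^sup>2"
      using x(3) r(2) n_pos by (simp add: power2_eq_square field_simps)
    \<comment> \<open>Orientation excludes b = -r, the opposite quarter turn.\<close>
    moreover have "b > 0"
      using x(4) An by (simp add: b_def)
    ultimately have "b = r"
      using r(1) by (simp add: power2_eq_iff_nonneg)
    then show ?thesis
      using xb by simp
  qed
  ultimately have "P (THE w. P w)"
    by (metis theI)
  then show "rotation M g p v \<in> ?T" "?G (rotation M g p v) (rotation M g p v) = ?G v v"
    unfolding P_def rotation_def by blast+
qed

lemma area_form_0: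
  assumes "oriented_riemannian_surface M g" "p \<in> points M"
  shows "area_form M g p 0 0 = 0"
proof -
  have M: "smooth_manifold M" "riemannian_metric M g"
    using assms by (simp_all add: oriented_riemannian_surface_def)
  have 0: "0 \<in> tangent_space M p"
    using subspace_0[OF subspace_tangent_space[OF M(1)]] .
  show ?thesis
    using metric_on_tangent_space(2)[OF M(2) assms(2) 0 0 0, of 0 0] rotation_0[OF assms]
    by (simp add: area_form_def)
qed

text \<open>The witness is the rotation of v, which pairs with v to g(v,v).\<close>

lemma area_form_nondegenerate:
  assumes "oriented_riemannian_surface M g" "p \<in> points M"
    and v: "v \<in> tangent_space M p" "v \<noteq> 0"
  obtains w where "w \<in> tangent_space M p" "area_form M g p v w \<noteq> 0"
proof
  show "rotation M g p v \<in> tangent_space M p"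
    by (rule rotation_works[OF assms])
  have "g p v v > 0"
    using metric_on_tangent_space(3) assms by (metis oriented_riemannian_surface_def)
  then show "area_form M g p v (rotation M g p v) \<noteq> 0"
    using rotation_works(2)[OF assms] by (simp add: area_form_def)
qed

text \<open>Nondegeneracy yields a partner in the target plane only; surjectivity of the
  differential pulls both vectors back to S.\<close>

lemma area_form_differential_nonzero:
  fixes S :: "'s surface"
  assumes S: "smooth_manifold S" "p \<in> points S" and N: "oriented_riemannian_surface N g"
    and f: "continuous_map (mtop S) (mtop N) f" "differentiable_in_charts S N f p"
    and inj: "inj_on (differential S N f p) (tangent_space S p)"
  obtains v w where "v \<in> tangent_space S p" "w \<in> tangent_space S p"
    "area_form N g (f p) (differential S N f p v) (differential S N f p w) \<noteq> 0"
proof -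
  have N': "smooth_manifold N"
    using N by (simp add: oriented_riemannian_surface_def)
  have q: "f p \<in> points N"
    by (rule continuous_map_points[OF f(1) S(2)])
  note onto = differential_onto[OF S N' f inj]
  obtain d where d: "d \<in> charts_at N (f p)"
    using charts_at_nonempty[OF N' q] by blast
  \<comment> \<open>Here \<open>1\<close> is the vector with all entries 1; any nonzero vector would
    do.\<close>
  define x where "x = coord_vector N d (f p) 1"
  have "x d \<noteq> 0"
    unfolding x_def coord_vector_same[OF N' d] by simp
  then have "x \<noteq> 0"
    by (metis zero_fun_apply)
  have x: "x \<in> tangent_space N (f p)"
    unfolding x_def by (rule coord_vector_in_tangent_space[OF N' d])
  obtain y where y: "y \<in> tangent_space N (f p)" "area_form N g (f p) x y \<noteq> 0"
    using area_form_nondegenerate[OF N q x \<open>x \<noteq> 0\<close>] .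
  obtain v where v: "v \<in> tangent_space S p" "x = differential S N f p v"
    using x unfolding onto[symmetric] by (rule imageE)
  obtain w where w: "w \<in> tangent_space S p" "y = differential S N f p w"
    using y(1) unfolding onto[symmetric] by (rule imageE)
  show ?thesis
    by (rule that[OF v(1) w(1) y(2)[unfolded v(2) w(2)]])
qed


section \<open>Products\<close>

lemma product_charts:
  "charts_at (product_manifold M N) q =
     {(fst c \<times> fst d, map_prod (snd c) (snd d)) | c d. c \<in> charts_at M (fst q) \<and> d \<in> charts_at N (snd q)}"
  by (auto simp: charts_at_def product_manifold_def mem_Times_iff) blast

text \<open>Injectivity makes the choice in \<open>inv_into\<close> unique, so the inverse splits on
  the product of the chart images.\<close>

lemma product_chart_inv:
  assumes "inj_on (snd c) (fst c)" "inj_on (snd d) (fst d)"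
    and "x \<in> snd c ` fst c" "y \<in> snd d ` fst d"
  shows "chart_inv (fst c \<times> fst d, map_prod (snd c) (snd d)) (x, y) = (chart_inv c x, chart_inv d y)"
proof -
  have "inj_on (map_prod (snd c) (snd d)) (fst c \<times> fst d)"
    using assms(1,2) by (rule map_prod_inj_on)
  then show ?thesis
    unfolding chart_inv_def fst_conv snd_conv
    using assms(3,4) by (intro inv_into_f_eq) (auto simp: inv_into_into f_inv_into_f)
qed

text \<open>In a product chart with factors c and d, the projections read
  \<open>transition c e \<circ> fst\<close> and \<open>transition d e \<circ> snd\<close>. The
  equality holds on the product of the chart images, which is open and contains the point.\<close>

lemma differentiable_in_charts_projections:
  assumes M: "smooth_manifold M" and N: "smooth_manifold N"
  shows "differentiable_in_charts (product_manifold M N) M fst q"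
    and "differentiable_in_charts (product_manifold M N) N snd q"
proof -
  have "(snd e \<circ> fst \<circ> chart_inv b) differentiable (at (snd b q))"
    if b: "b \<in> charts_at (product_manifold M N) q" and e: "e \<in> charts_at M (fst q)" for b e
  proof -
    obtain c d where c: "c \<in> charts_at M (fst q)" and d: "d \<in> charts_at N (snd q)"
      and b: "b = (fst c \<times> fst d, map_prod (snd c) (snd d))"
      using b unfolding product_charts by blast
    note C = smooth_manifold_chart[OF M c] and D = smooth_manifold_chart[OF N d]
    have "(transition c e \<circ> fst) differentiable (at (snd b q))"
    proof (rule differentiable_chain_at)
      show "fst differentiable (at (snd b q))"
        by (rule bounded_linear_imp_differentiable[OF bounded_linear_fst])
      show "transition c e differentiable (at (fst (snd b q)))"
        using transition_differentiable[OF M c e] by (simp add: b)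
    qed
    then have "((transition c e \<circ> fst) has_derivative frechet_derivative (transition c e \<circ> fst) (at (snd b q)))
        (at (snd b q))"
      using frechet_derivative_works by blast
    then have "(snd e \<circ> fst \<circ> chart_inv b has_derivative
        frechet_derivative (transition c e \<circ> fst) (at (snd b q))) (at (snd b q))"
      by (rule has_derivative_transform_within_open[OF _ open_Times[OF C(4) D(4)]])
         (use C(2,5) D(2,5) in \<open>auto simp: b product_chart_inv transition_def mem_Times_iff\<close>)
    then show ?thesis
      by (rule differentiableI)
  qed
  then show "differentiable_in_charts (product_manifold M N) M fst q"
    by (simp add: differentiable_in_charts_def)
  have "(snd e \<circ> snd \<circ> chart_inv b) differentiable (at (snd b q))"
    if b: "b \<in> charts_at (product_manifold M N) q" and e: "e \<in> charts_at N (snd q)" for b e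
  proof -
    obtain c d where c: "c \<in> charts_at M (fst q)" and d: "d \<in> charts_at N (snd q)"
      and b: "b = (fst c \<times> fst d, map_prod (snd c) (snd d))"
      using b unfolding product_charts by blast
    note C = smooth_manifold_chart[OF M c] and D = smooth_manifold_chart[OF N d]
    have "(transition d e \<circ> snd) differentiable (at (snd b q))"
    proof (rule differentiable_chain_at)
      show "snd differentiable (at (snd b q))"
        by (rule bounded_linear_imp_differentiable[OF bounded_linear_snd])
      show "transition d e differentiable (at (snd (snd b q)))"
        using transition_differentiable[OF N d e] by (simp add: b)
    qed
    then have "((transition d e \<circ> snd) has_derivative frechet_derivative (transition d e \<circ> snd) (at (snd b q)))
        (at (snd b q))"
      using frechet_derivative_works by blast
    then have "(snd e \<circ> snd \<circ> chart_inv b has_derivative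
        frechet_derivative (transition d e \<circ> snd) (at (snd b q))) (at (snd b q))"
      by (rule has_derivative_transform_within_open[OF _ open_Times[OF C(4) D(4)]])
         (use C(2,5) D(2,5) in \<open>auto simp: b product_chart_inv transition_def mem_Times_iff\<close>)
    then show ?thesis
      by (rule differentiableI)
  qed
  then show "differentiable_in_charts (product_manifold M N) N snd q"
    by (simp add: differentiable_in_charts_def)
qed

section \<open>Maps into a product and their components\<close>

context
  fixes S :: "('s, 'e::euclidean_space) manifold" and M :: "('a, 'f::euclidean_space) manifold"
    and N :: "('b, 'h::euclidean_space) manifold" and \<Phi> :: "'s \<Rightarrow> 'a \<times> 'b"
  assumes S: "smooth_manifold S" and M: "smooth_manifold M" and N: "smooth_manifold N"
    and \<Phi>: "smooth_map S (product_manifold M N) \<Phi>"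
begin

lemma continuous_components:
  "continuous_map (mtop S) (mtop M) (fst \<circ> \<Phi>)" "continuous_map (mtop S) (mtop N) (snd \<circ> \<Phi>)"
  using \<Phi> by (auto simp: smooth_map_def product_manifold_def continuous_map_pairwise)

lemma product_chart_nonempty:
  assumes p: "p \<in> points S"
  shows "charts_at M (fst (\<Phi> p)) \<noteq> {}" "charts_at N (snd (\<Phi> p)) \<noteq> {}"
  using charts_at_nonempty[OF M continuous_map_points[OF continuous_components(1) p]]
    charts_at_nonempty[OF N continuous_map_points[OF continuous_components(2) p]]
  by simp_all

text \<open>In a product chart, \<Phi> is the pair of the coordinate expressions of its components,
  so \<open>L\<close> splits accordingly.\<close>

lemma has_derivative_components:
  assumes s: "s \<in> charts_at S p"
    and c: "c \<in> charts_at M (fst (\<Phi> p))" and d: "d \<in> charts_at N (snd (\<Phi> p))"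
  defines "L \<equiv> frechet_derivative (map_prod (snd c) (snd d) \<circ> \<Phi> \<circ> chart_inv s) (at (snd s p))"
  shows "(snd c \<circ> (fst \<circ> \<Phi>) \<circ> chart_inv s has_derivative (\<lambda>a. fst (L a))) (at (snd s p))"
    and "(snd d \<circ> (snd \<circ> \<Phi>) \<circ> chart_inv s has_derivative (\<lambda>a. snd (L a))) (at (snd s p))"
proof -
  have "(fst c \<times> fst d, map_prod (snd c) (snd d)) \<in> charts_at (product_manifold M N) (\<Phi> p)"
    unfolding product_charts using c d by blast
  then have "(map_prod (snd c) (snd d) \<circ> \<Phi> \<circ> chart_inv s) differentiable (at (snd s p))"
    using smooth_map_differentiable_in_charts[OF \<Phi>, of p] s
    unfolding differentiable_in_charts_def by fastforce
  then have L: "((map_prod (snd c) (snd d) \<circ> \<Phi> \<circ> chart_inv s) has_derivative L) (at (snd s p))"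
    unfolding L_def using frechet_derivative_works by blast
  show "(snd c \<circ> (fst \<circ> \<Phi>) \<circ> chart_inv s has_derivative (\<lambda>a. fst (L a))) (at (snd s p))"
    using has_derivative_fst[OF L] by (simp add: comp_def)
  show "(snd d \<circ> (snd \<circ> \<Phi>) \<circ> chart_inv s has_derivative (\<lambda>a. snd (L a))) (at (snd s p))"
    using has_derivative_snd[OF L] by (simp add: comp_def)
qed

text \<open>A chart of one factor enters the product atlas only when paired with one of the other
  factor, so the latter must have a chart at the image point.\<close>

lemma differentiable_components:
  assumes p: "p \<in> points S"
  shows "differentiable_in_charts S M (fst \<circ> \<Phi>) p" "differentiable_in_charts S N (snd \<circ> \<Phi>) p"
  using has_derivative_components product_chart_nonempty[OF p]
  unfolding differentiable_in_charts_def by (fastforce intro: differentiableI)+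

text \<open>All three differentials use the same source chart, as its choice depends only on S and
  p; the coordinates can therefore be compared directly.\<close>

lemma differential_product:
  assumes p: "p \<in> points S"
    and c: "c \<in> charts_at M (fst (\<Phi> p))" and d: "d \<in> charts_at N (snd (\<Phi> p))"
  shows "differential S (product_manifold M N) \<Phi> p v (fst c \<times> fst d, map_prod (snd c) (snd d)) =
     (differential S M (fst \<circ> \<Phi>) p v c, differential S N (snd \<circ> \<Phi>) p v d)"
proof -
  have "(fst c \<times> fst d, map_prod (snd c) (snd d)) \<in> charts_at (product_manifold M N) (\<Phi> p)"
    unfolding product_charts using c d by blast
  then show ?thesis
    using has_derivative_components[OF some_chart[OF charts_at_nonempty[OF S p]] c d] c d
    by (simp add: differential_def Let_def frechet_derivative_at[symmetric])
qed

text \<open>This evaluates the pullbacks inside \<open>product_form\<close>. The product charts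
  inherit open domains and injectivity from their factors, as the chain rule requires.\<close>

lemma differential_components:
  assumes p: "p \<in> points S"
  shows "differential (product_manifold M N) M fst (\<Phi> p) (differential S (product_manifold M N) \<Phi> p v)
      = differential S M (fst \<circ> \<Phi>) p v"
    and "differential (product_manifold M N) N snd (\<Phi> p) (differential S (product_manifold M N) \<Phi> p v)
      = differential S N (snd \<circ> \<Phi>) p v"
proof -
  have charts: "openin (mtop (product_manifold M N)) (fst b) \<and> inj_on (snd b) (fst b)"
    if "b \<in> charts_at (product_manifold M N) (\<Phi> p)" for b
    using that smooth_manifold_chart(3,5)[OF M] smooth_manifold_chart(3,5)[OF N]
    unfolding product_charts
    by (auto simp: product_manifold_def openin_prod_Times_iff intro!: map_prod_inj_on)
  have nonempty: "charts_at (product_manifold M N) (\<Phi> p) \<noteq> {}"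
    using product_chart_nonempty[OF p] unfolding product_charts by blast
  have cont: "continuous_map (mtop S) (mtop (product_manifold M N)) \<Phi>"
    using \<Phi> by (simp add: smooth_map_def)
  note comp = differential_comp[OF S p charts nonempty cont smooth_map_differentiable_in_charts[OF \<Phi>]]
  show "differential (product_manifold M N) M fst (\<Phi> p) (differential S (product_manifold M N) \<Phi> p v)
      = differential S M (fst \<circ> \<Phi>) p v"
    by (rule comp[OF _ differentiable_in_charts_projections(1)[OF M N]])
  show "differential (product_manifold M N) N snd (\<Phi> p) (differential S (product_manifold M N) \<Phi> p v)
      = differential S N (snd \<circ> \<Phi>) p v"
    by (rule comp[OF _ differentiable_in_charts_projections(2)[OF M N]])
qed

text \<open>The product atlas consists of product charts alone, and off the charts at the image
  point both sides are 0. Injectivity of d\<Phi> thus becomes joint injectivity of the component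
  differentials.\<close>

lemma differential_product_eqI:
  assumes p: "p \<in> points S"
    and "differential S M (fst \<circ> \<Phi>) p v = differential S M (fst \<circ> \<Phi>) p w"
    and "differential S N (snd \<circ> \<Phi>) p v = differential S N (snd \<circ> \<Phi>) p w"
  shows "differential S (product_manifold M N) \<Phi> p v = differential S (product_manifold M N) \<Phi> p w"
proof
  fix b
  show "differential S (product_manifold M N) \<Phi> p v b = differential S (product_manifold M N) \<Phi> p w b"
  proof (cases "b \<in> charts_at (product_manifold M N) (\<Phi> p)")
    case True
    then show ?thesis
      using differential_product[OF p] assms(2,3) unfolding product_charts by auto
  qed (simp add: differential_def Let_def)
qed

end


theorem proposition2:
  fixes \<Sigma>1 :: "'a surface" and g1 :: "('a, real^2) bilinear_field"
    and \<Sigma>2 :: "'b surface" and g2 :: "('b, real^2) bilinear_field"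
    and \<epsilon> :: real
  assumes "oriented_riemannian_surface \<Sigma>1 g1" "connected_space (mtop \<Sigma>1)" "riemannian_complete \<Sigma>1 g1"
    and "oriented_riemannian_surface \<Sigma>2 g2" "connected_space (mtop \<Sigma>2)" "riemannian_complete \<Sigma>2 g2"
    and "\<epsilon> \<in> {1, -1}"
  shows "\<not> (\<exists>(S :: 's surface) \<Phi>.
           smooth_manifold S \<and> points S \<noteq> {} \<and>
           lagrangian_immersion S \<Sigma>1 g1 \<Sigma>2 g2 \<epsilon> \<Phi> \<and>
           projected_rank_zero S \<Sigma>1 \<Sigma>2 \<Phi>)"
proof
  assume "\<exists>(S :: 's surface) \<Phi>.
           smooth_manifold S \<and> points S \<noteq> {} \<and>
           lagrangian_immersion S \<Sigma>1 g1 \<Sigma>2 g2 \<epsilon> \<Phi> \<and>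
           projected_rank_zero S \<Sigma>1 \<Sigma>2 \<Phi>"
  then obtain S :: "'s surface" and \<Phi> p where S: "smooth_manifold S" and p: "p \<in> points S"
    and lag: "lagrangian_immersion S \<Sigma>1 g1 \<Sigma>2 g2 \<epsilon> \<Phi>"
    and rank: "projected_rank_zero S \<Sigma>1 \<Sigma>2 \<Phi>"
    by blast
  let ?P = "product_manifold \<Sigma>1 \<Sigma>2"
  let ?T = "tangent_space S p"
  let ?d1 = "differential S \<Sigma>1 (fst \<circ> \<Phi>) p"
  let ?d2 = "differential S \<Sigma>2 (snd \<circ> \<Phi>) p"
  have \<Sigma>: "smooth_manifold \<Sigma>1" "smooth_manifold \<Sigma>2"
    using assms by (simp_all add: oriented_riemannian_surface_def)
  have \<Phi>: "smooth_map S ?P \<Phi>" and inj: "inj_on (differential S ?P \<Phi> p) ?T"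
    using lag p by (auto simp: lagrangian_immersion_def immersion_def)
  note cont = continuous_components[OF S \<Sigma> \<Phi>]
  note diff = differentiable_components[OF S \<Sigma> \<Phi> p]
  have q: "(fst \<circ> \<Phi>) p \<in> points \<Sigma>1" "(snd \<circ> \<Phi>) p \<in> points \<Sigma>2"
    by (rule continuous_map_points[OF cont(1) p], rule continuous_map_points[OF cont(2) p])
  have form: "area_form \<Sigma>1 g1 ((fst \<circ> \<Phi>) p) (?d1 v) (?d1 w) +
      \<epsilon> * area_form \<Sigma>2 g2 ((snd \<circ> \<Phi>) p) (?d2 v) (?d2 w) = 0" if "v \<in> ?T" "w \<in> ?T" for v w
  proof -
    have "pullback S ?P \<Phi> (product_form \<Sigma>1 g1 \<Sigma>2 g2 \<epsilon>) p v w = 0"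
      using lag p that by (simp add: lagrangian_immersion_def)
    then show ?thesis
      unfolding pullback_def product_form_def differential_components[OF S \<Sigma> \<Phi> p] comp_apply .
  qed
  have inj2: "v = w" if "v \<in> ?T" "w \<in> ?T" "?d1 v = ?d1 w" "?d2 v = ?d2 w" for v w
    using inj_onD[OF inj differential_product_eqI[OF S \<Sigma> \<Phi> p that(3,4)] that(1,2)] .
  consider "rank_at S \<Sigma>1 (fst \<circ> \<Phi>) p = 0" | "rank_at S \<Sigma>2 (snd \<circ> \<Phi>) p = 0"
    using rank p by (auto simp: projected_rank_zero_def projected_rank_zero_at_def)
  then show False
  proof cases
    case 1
    then have d1: "?d1 v = 0" if "v \<in> ?T" for v
      using rank_at_eq_0[OF S p diff(1)] that by blast
    \<comment> \<open>With the first differential zero, joint injectivity rests on the second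
      alone.\<close>
    then have "inj_on ?d2 ?T"
      using inj2 by (auto intro!: inj_onI)
    then obtain v w where "v \<in> ?T" "w \<in> ?T"
      "area_form \<Sigma>2 g2 ((snd \<circ> \<Phi>) p) (?d2 v) (?d2 w) \<noteq> 0"
      using area_form_differential_nonzero[OF S p assms(4) cont(2) diff(2)] by blast
    then show False
      \<comment> \<open>The first summand is an area form at the pair (0, 0), and \<epsilon> =
        \<plusminus>1 can be cancelled from the second.\<close>
      using form[of v w] d1 area_form_0[OF assms(1) q(1)] assms(7) by auto
  next
    case 2
    then have d2: "?d2 v = 0" if "v \<in> ?T" for v
      using rank_at_eq_0[OF S p diff(2)] that by blast
    then have "inj_on ?d1 ?T"
      using inj2 by (auto intro!: inj_onI)
    then obtain v w where "v \<in> ?T" "w \<in> ?T"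
      "area_form \<Sigma>1 g1 ((fst \<circ> \<Phi>) p) (?d1 v) (?d1 w) \<noteq> 0"
      using area_form_differential_nonzero[OF S p assms(1) cont(1) diff(1)] by blast
    then show False
      using form[of v w] d2 area_form_0[OF assms(4) q(2)] by auto
  qed
qed

end
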